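(* Let $\zeta(m,r,s)$ (written $\zeta(r)$) be the formal power series in $r$ satisfying $$1=(1+rs(m-2))\zeta(r)+rs\,\zeta(r)\zeta(rs)+rs(1+rs^2(m-1))\zeta(r)\zeta(rs)\zeta(rs^2)+r^2s^3\zeta(r)\zeta(rs)\zeta(rs^2)\zeta(rs^3).$$ Then at $m=1$, $$\zeta(1,r,s)=\sum_{n\ge 0}(-rs)^{n}\sum_{\mu\in\mathtt{Dyck}(n;2)}s^{\mathrm{Area}(\mu)}.$$
   Context: A $2$-Dyck path of size $n$ is a lattice path from $(0,0)$ to $(2n,n)$ consisting of up steps $U=(0,1)$ and down steps $D=(1,0)$ which never goes below the line $y=x/2$; $\mathtt{Dyck}(n;2)$ is the set of them. $\mathrm{Area}(\mu)$ is the number of unit boxes above the lowest path $\mu_0=(UD^2)^n$ and below $\mu$. Power series in $r$ have coefficients in $\mathbb{Z}[m,s]$. *)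

theory Defs
  imports "HOL-Computational_Algebra.Computational_Algebra"
begin

(* Z[m,s] is modelled as Z[s][m], i.e. "int poly poly" with outer indeterminate m and inner
   indeterminate s; the indeterminate r of the power series is fps_X. *)

definition var_m :: "int poly poly fps"
  where "var_m = fps_const [:0, 1:]"

definition var_s :: "int poly poly fps"
  where "var_s = fps_const [:[:0, 1:]:]"

(* The indeterminate s in Z[s][[r]], the ring that remains after specialising m. *)
definition var_s' :: "int poly fps"
  where "var_s' = fps_const [:0, 1:]"

definition specialise_m :: "int poly \<Rightarrow> int poly poly fps \<Rightarrow> int poly fps"
  where "specialise_m c f = Abs_fps (\<lambda>n. poly (fps_nth f n) c)"

(* The substitution r := r s^k. *)
definition shift_s :: "nat \<Rightarrow> int poly poly fps \<Rightarrow> int poly poly fps"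
  where "shift_s k f = fps_compose f (fps_X * var_s ^ k)"

definition zeta_equation :: "int poly poly fps \<Rightarrow> bool"
  where "zeta_equation \<zeta> \<longleftrightarrow>
    1 = (1 + fps_X * var_s * (var_m - 2)) * \<zeta>
      + fps_X * var_s * \<zeta> * shift_s 1 \<zeta>
      + fps_X * var_s * (1 + fps_X * var_s ^ 2 * (var_m - 1)) * \<zeta> * shift_s 1 \<zeta> * shift_s 2 \<zeta>
      + fps_X ^ 2 * var_s ^ 3 * \<zeta> * shift_s 1 \<zeta> * shift_s 2 \<zeta> * shift_s 3 \<zeta>"

datatype step = Up | Down

fun move :: "step \<Rightarrow> nat \<times> nat \<Rightarrow> nat \<times> nat"
  where "move Up (x, y) = (x, y + 1)"
  | "move Down (x, y) = (x + 1, y)"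

definition endpoint :: "step list \<Rightarrow> nat \<times> nat"
  where "endpoint w = fold move w (0, 0)"

(* The visited lattice points are the endpoints of the prefixes. Since the steps are straight,
   it suffices to require y >= x/2, i.e. x <= 2 y, at these points. *)
definition Dyck2 :: "nat \<Rightarrow> step list set"
  where "Dyck2 n = {w. endpoint w = (2 * n, n) \<and>
    (\<forall>k \<le> length w. case endpoint (take k w) of (x, y) \<Rightarrow> x \<le> 2 * y)}"

(* The pair (i, j) stands for the unit box [i, i+1] x [j, j+1]. A path has exactly one Down step
   over the column [i, i+1]; if it starts at (i, h), the box lies below the path iff j + 1 <= h
   and above it iff h <= j. *)
definition boxes_below :: "step list \<Rightarrow> (nat \<times> nat) set"
  where "boxes_below w = {(i, j). \<exists>u v h. w = u @ Down # v \<and> endpoint u = (i, h) \<and> j + 1 \<le> h}"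

definition boxes_above :: "step list \<Rightarrow> (nat \<times> nat) set"
  where "boxes_above w = {(i, j). \<exists>u v h. w = u @ Down # v \<and> endpoint u = (i, h) \<and> h \<le> j}"

definition lowest_path :: "nat \<Rightarrow> step list"
  where "lowest_path n = concat (replicate n [Up, Down, Down])"

definition Area :: "nat \<Rightarrow> step list \<Rightarrow> nat"
  where "Area n \<mu> = card (boxes_above (lowest_path n) \<inter> boxes_below \<mu>)"

(* The functional equation determines \<zeta>: it has the form \<zeta> = 1 - r G(\<zeta>), where the coefficient
   of r^n in G(\<zeta>) depends only on the coefficients of \<zeta> up to r^n. *)

definition agree :: "nat \<Rightarrow> 'a::comm_ring_1 fps \<Rightarrow> 'a fps \<Rightarrow> bool"
  where "agree n f g \<longleftrightarrow> (\<forall>i<n. fps_nth f i = fps_nth g i)"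

lemma agree_refl: "agree n f f"
  by (simp add: agree_def)

lemma agree_add: "agree n f f' \<Longrightarrow> agree n g g' \<Longrightarrow> agree n (f + g) (f' + g')"
  by (simp add: agree_def)

lemma agree_mult: "agree n f f' \<Longrightarrow> agree n g g' \<Longrightarrow> agree n (f * g) (f' * g')"
  by (auto simp: agree_def fps_mult_nth intro!: sum.cong)

lemma shift_s_nth: "fps_nth (shift_s k f) n = [:[:0, 1:] ^ k:] ^ n * fps_nth f n"
proof -
  have "fps_X * var_s ^ k = fps_const [:[:0, 1:] ^ k:] * fps_X"
    by (simp add: var_s_def mult.commute poly_const_pow)
  then show ?thesis
    unfolding shift_s_def by (simp only: fps_nth_compose_linear)
qed

lemma agree_shift_s: "agree n f g \<Longrightarrow> agree n (shift_s k f) (shift_s k g)"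
  by (simp add: agree_def shift_s_nth)

lemma contraction_unique_fixpoint:
  fixes F :: "'a::comm_ring_1 fps \<Rightarrow> 'a fps"
  assumes contr: "\<And>n f g. agree n f g \<Longrightarrow> agree (Suc n) (F f) (F g)"
  shows "\<exists>!z. z = F z"
proof (rule ex_ex1I)
  define x where "x k = (F ^^ k) 0" for k
  define z where "z = Abs_fps (\<lambda>n. fps_nth (x (Suc n)) n)"
  have xF: "x (Suc k) = F (x k)" for k
    by (simp add: x_def)
  have step: "agree k (x k) (x (Suc k))" for k
  proof (induction k)
    case 0
    show ?case by (simp add: agree_def)
  next
    case (Suc k)
    then show ?case using contr xF by metis
  qed
  have mono: "agree k (x k) (x (k + j))" for k j
  proof (induction j)
    case 0
    show ?case by (simp add: agree_refl)
  next
    case (Suc j)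
    then show ?case using step[of "k + j"] by (simp add: agree_def)
  qed
  have xz: "agree k (x k) z" for k
    unfolding agree_def
  proof (intro allI impI)
    fix i assume "i < k"
    then obtain j where "k = Suc i + j"
      using less_iff_Suc_add by auto
    then show "fps_nth (x k) i = fps_nth z i"
      using mono[of "Suc i" j] by (simp add: agree_def z_def)
  qed
  have "fps_nth z n = fps_nth (F z) n" for n
    using contr[OF xz[of n]] xz[of "Suc n"] by (simp add: agree_def xF)
  then show "\<exists>z. z = F z"
    by (auto simp: fps_eq_iff)
next
  fix y z assume y: "y = F y" and z: "z = F z"
  have "agree n y z" for n
  proof (induction n)
    case 0
    show ?case by (simp add: agree_def)
  next
    case (Suc n)
    then show ?case using contr y z by metis
  qed
  then show "y = z"
    by (auto simp: fps_eq_iff agree_def)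
qed

lemma zeta_equation_unique_solution: "\<exists>!\<zeta>. zeta_equation \<zeta>"
proof -
  define G where "G z = var_s * (var_m - 2) * z + var_s * z * shift_s 1 z
      + var_s * (1 + fps_X * var_s ^ 2 * (var_m - 1)) * z * shift_s 1 z * shift_s 2 z
      + fps_X * var_s ^ 3 * z * shift_s 1 z * shift_s 2 z * shift_s 3 z" for z
  have G: "agree n (G f) (G g)" if "agree n f g" for n f g
    unfolding G_def by (intro agree_add agree_mult agree_refl agree_shift_s that)
  have "agree (Suc n) (1 - fps_X * G f) (1 - fps_X * G g)" if "agree n f g" for n f g
    using G[OF that] by (auto simp: agree_def)
  then have "\<exists>!z. z = 1 - fps_X * G z"
    by (rule contraction_unique_fixpoint)
  moreover have "zeta_equation z \<longleftrightarrow> z = 1 - fps_X * G z" for z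
  proof -
    have "zeta_equation z \<longleftrightarrow> 1 = z + fps_X * G z"
      unfolding zeta_equation_def G_def
      by (simp add: algebra_simps power2_eq_square)
    then show ?thesis by (auto simp: algebra_simps)
  qed
  ultimately show ?thesis by simp
qed

end

theory Submission
  imports Defs
begin

text \<open>
  Let \<open>c(r)\<close> be the series of \<open>2\<close>-Dyck paths by size and area, and \<open>z(r) = c(-rs)\<close>. A nonempty
  path is \<open>U A D B D C\<close> with \<open>2\<close>-Dyck paths \<open>A, B, C\<close>; raising \<open>A\<close> and \<open>B\<close> by two and by one
  adds \<open>2|A|\<close> and \<open>|B|\<close> to their areas, so \<open>z(r) = 1 - rs z(r) z(rs) z(rs\<^sup>2)\<close>. This relation and
  its image under \<open>r := rs\<close> combine to the equation for \<open>\<zeta>\<close> at \<open>m = 1\<close>, which has only one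
  solution.
\<close>

section \<open>Paths encoded by their excess\<close>

text \<open>
  The first argument of \<open>valid\<close> and \<open>area_from\<close> is the excess \<open>2y - x\<close> at the starting point.
  A down step from excess \<open>e > 0\<close> has \<open>(e - 1) div 2\<close> boxes between it and the lowest path.
\<close>

fun valid :: "nat \<Rightarrow> step list \<Rightarrow> bool"
  where "valid e [] \<longleftrightarrow> e = 0"
  | "valid e (Up # w) \<longleftrightarrow> valid (e + 2) w"
  | "valid e (Down # w) \<longleftrightarrow> 0 < e \<and> valid (e - 1) w"

fun area_from :: "nat \<Rightarrow> step list \<Rightarrow> nat"
  where "area_from e [] = 0"
  | "area_from e (Up # w) = area_from (e + 2) w"
  | "area_from e (Down # w) = (e - 1) div 2 + area_from (e - 1) w"

definition ups :: "step list \<Rightarrow> nat"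
  where "ups w = count_list w Up"

definition paths :: "nat \<Rightarrow> nat \<Rightarrow> step list set"
  where "paths e n = {w. valid e w \<and> ups w = n}"

lemma ups_simps [simp]:
  "ups [] = 0" "ups (Up # w) = Suc (ups w)" "ups (Down # w) = ups w" "ups (u @ v) = ups u + ups v"
  by (simp_all add: ups_def)

text \<open>An up step adds 2 to the excess and a down step removes 1, so reaching excess 0 from
  \<open>e\<close> takes \<open>2 * ups w + e\<close> down steps. This bounds the words in
  \<open>paths e n\<close>.\<close>

lemma length_valid: "valid e w \<Longrightarrow> length w = 3 * ups w + e"
  by (induction e w rule: valid.induct) auto

lemma finite_paths: "finite (paths e n)"
proof (rule finite_subset)
  show "paths e n \<subseteq> {w. set w \<subseteq> {Up, Down} \<and> length w = 3 * n + e}"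
    using length_valid step.exhaust by (auto simp: paths_def)
qed (simp add: finite_lists_length_eq)

text \<open>Lifted by \<open>k\<close>, the factor \<open>u\<close> never falls below level
  \<open>k\<close> and ends there, so only \<open>v\<close> remains to be checked.\<close>

lemma valid_append: "valid e u \<Longrightarrow> valid (e + k) (u @ v) \<longleftrightarrow> valid k v"
  by (induction e u rule: valid.induct) auto

lemma area_from_append:
  "valid e u \<Longrightarrow> area_from (e + k) (u @ v) = area_from (e + k) u + area_from k v"
  by (induction e u rule: valid.induct) auto

text \<open>Exactly the down steps from even excess gain a box. The down steps start from the levels
  \<open>1..e\<close> and from two consecutive levels for each up step, so
  \<open>e div 2 + ups w\<close> of them start from even excess.\<close>

lemma area_from_shift_1: "valid e w \<Longrightarrow> area_from (e + 1) w = area_from e w + ups w + e div 2"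
proof (induction e w rule: valid.induct)
  case (3 e w)
  then show ?case by (cases e) auto
qed auto

text \<open>Every down step gains exactly one box, and there are \<open>2 * ups w + e\<close> of
  them.\<close>

lemma area_from_shift_2: "valid e w \<Longrightarrow> area_from (e + 2) w = area_from e w + 2 * ups w + e"
proof (induction e w rule: valid.induct)
  case (3 e w)
  then show ?case by (cases e) auto
qed auto

section \<open>Decomposition at the first descent\<close>

text \<open>Cut at the first step below the final excess of the left factor.\<close>

lemma valid_decompose:
  "valid (e + Suc k) w \<Longrightarrow> \<exists>u v. w = u @ Down # v \<and> valid e u \<and> valid k v"
proof (induction "e + Suc k" w arbitrary: e rule: valid.induct)
  case (2 w)
  from "2.hyps"[of "e + 2"] "2.prems" obtain u v
    where "w = u @ Down # v" "valid (e + 2) u" "valid k v" by auto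
  then show ?case by (intro exI[of _ "Up # u"] exI[of _ v]) simp
next
  case (3 w)
  show ?case
  proof (cases e)
    case 0
    with "3.prems" show ?thesis by (intro exI[of _ "[]"] exI[of _ w]) simp
  next
    case (Suc e')
    with "3.hyps"[of e'] "3.prems" obtain u v
      where "w = u @ Down # v" "valid e' u" "valid k v" by auto
    with Suc show ?thesis by (intro exI[of _ "Down # u"] exI[of _ v]) simp
  qed
qed simp

text \<open>If one of \<open>u\<close>, \<open>u'\<close> were a proper prefix of the other, the
  \<open>Down\<close> following it would leave excess 0 inside the longer word, which
  \<open>valid\<close> forbids.\<close>

lemma decompose_unique:
  "valid e u \<Longrightarrow> valid e u' \<Longrightarrow> u @ Down # v = u' @ Down # v' \<Longrightarrow> u = u' \<and> v = v'"
proof (induction e u arbitrary: u' rule: valid.induct)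
  case (1 e)
  then show ?case by (cases u') auto
next
  case (2 e w)
  from "2.prems" obtain w' where "u' = Up # w'" by (cases u') auto
  with "2.IH"[of w'] "2.prems" show ?case by simp
next
  case (3 e w)
  from "3.prems" obtain w' where "u' = Down # w'" by (cases u') auto
  with "3.IH"[of w'] "3.prems" show ?case by simp
qed

text \<open>Cutting is a bijection: surjective by \<open>valid_decompose\<close>, injective by
  \<open>decompose_unique\<close>. The left factor returns to its starting level and so counts as a
  path from excess 0; the separating \<open>Down\<close> uses none of the \<open>n\<close> up
  steps.\<close>

lemma sum_paths_Suc:
  fixes g :: "step list \<Rightarrow> 'a::comm_monoid_add"
  shows "sum g (paths (Suc k) n)
    = (\<Sum>i\<le>n. \<Sum>u\<in>paths 0 i. \<Sum>v\<in>paths k (n - i). g (u @ Down # v))"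
proof -
  let ?S = "SIGMA i:{..n}. paths 0 i \<times> paths k (n - i)"
  let ?h = "\<lambda>(i, u, v). u @ Down # v"
  have inj: "inj_on ?h ?S"
    by (auto simp: inj_on_def paths_def dest: decompose_unique)
  have "w \<in> ?h ` ?S" if "w \<in> paths (Suc k) n" for w
  proof -
    from that valid_decompose[of 0 k w] obtain u v
      where "w = u @ Down # v" "valid 0 u" "valid k v" by (auto simp: paths_def)
    with that show ?thesis
      by (intro image_eqI[of _ _ "(ups u, u, v)"]) (auto simp: paths_def)
  qed
  moreover have "?h ` ?S \<subseteq> paths (Suc k) n"
    using valid_append[of 0 _ "Suc k"] by (auto simp: paths_def)
  ultimately have "paths (Suc k) n = ?h ` ?S" by blast
  then have "sum g (paths (Suc k) n) = (\<Sum>(i, u, v)\<in>?S. g (u @ Down # v))"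
    by (simp only: sum.reindex[OF inj]) (simp add: case_prod_unfold comp_def)
  also have "\<dots> = (\<Sum>i\<le>n. \<Sum>u\<in>paths 0 i. \<Sum>v\<in>paths k (n - i). g (u @ Down # v))"
    by (subst sum.Sigma[symmetric]) (simp_all add: finite_paths sum.cartesian_product)
  finally show ?thesis .
qed

section \<open>Generating functions by size and area\<close>

text \<open>At \<open>e = 0\<close> this is the series c(r), with \<open>q\<close> for s. The cases
  \<open>e = 2\<close> and \<open>e = 1\<close> count what is left of a nonempty path after U and
  after U A D.\<close>

definition area_gf :: "'a::comm_ring_1 \<Rightarrow> nat \<Rightarrow> 'a fps"
  where "area_gf q e = Abs_fps (\<lambda>n. \<Sum>w\<in>paths e n. q ^ area_from e w)"

text \<open>One operator for both r := rs^k and the sign change r := -rs.\<close>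

definition scale :: "'a::comm_ring_1 \<Rightarrow> 'a fps \<Rightarrow> 'a fps"
  where "scale c f = fps_compose f (fps_const c * fps_X)"

lemma scale_nth: "fps_nth (scale c f) n = c ^ n * fps_nth f n"
  unfolding scale_def by (rule fps_nth_compose_linear)

lemma scale_add: "scale c (f + g) = scale c f + scale c g"
  by (simp add: fps_eq_iff scale_nth algebra_simps)

lemma scale_diff: "scale c (f - g) = scale c f - scale c g"
  by (simp add: fps_eq_iff scale_nth algebra_simps)

lemma scale_one: "scale c 1 = 1"
  by (simp add: fps_eq_iff scale_nth)

lemma scale_const: "scale c (fps_const a) = fps_const a"
  by (simp add: fps_eq_iff scale_nth)

lemma scale_X: "scale c fps_X = fps_const c * fps_X"
  by (rule fps_ext) (simp only: scale_nth fps_mult_left_const_nth fps_X_nth, simp)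

lemma scale_mult: "scale c (f * g) = scale c f * scale c g"
proof (rule fps_ext)
  fix n
  have "fps_nth (scale c (f * g)) n
      = (\<Sum>i=0..n. c ^ i * c ^ (n - i) * (fps_nth f i * fps_nth g (n - i)))"
    by (simp add: scale_nth fps_mult_nth sum_distrib_left flip: power_add)
  then show "fps_nth (scale c (f * g)) n = fps_nth (scale c f * scale c g) n"
    by (simp add: scale_nth fps_mult_nth mult_ac)
qed

lemma scale_scale: "scale a (scale b f) = scale (a * b) f"
  by (simp add: fps_eq_iff scale_nth power_mult_distrib mult_ac)

lemma paths_0_Suc: "paths 0 (Suc n) = (#) Up ` paths 2 n"
proof (rule set_eqI)
  fix w
  show "w \<in> paths 0 (Suc n) \<longleftrightarrow> w \<in> (#) Up ` paths 2 n"
  proof (cases w)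
    case (Cons d v)
    then show ?thesis by (cases d) (auto simp: paths_def numeral_2_eq_2)
  qed (auto simp: paths_def)
qed

lemma paths_0_0: "paths 0 0 = {[]}"
  using length_valid by (fastforce simp: paths_def)

lemma area_gf_0: "area_gf q 0 = 1 + fps_X * area_gf q 2"
proof (rule fps_ext)
  fix n
  show "fps_nth (area_gf q 0) n = fps_nth (1 + fps_X * area_gf q 2) n"
    by (cases n) (simp_all add: area_gf_def paths_0_0 paths_0_Suc sum.reindex numeral_2_eq_2)
qed

text \<open>Lifting \<open>u\<close> multiplies its weight by \<open>(q ^ Suc k) ^ ups u\<close>,
  which is a substitution in r. For \<open>k < 2\<close> the separating down step has
  \<open>k div 2 = 0\<close> boxes and adds no weight.\<close>

lemma area_gf_Suc:
  assumes "\<And>u. valid 0 u \<Longrightarrow> area_from (Suc k) u = area_from 0 u + Suc k * ups u"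
    and "k < 2"
  shows "area_gf q (Suc k) = scale (q ^ Suc k) (area_gf q 0) * area_gf q k"
proof (rule fps_ext)
  fix n
  have "q ^ area_from (Suc k) (u @ Down # v)
      = (q ^ Suc k) ^ i * q ^ area_from 0 u * q ^ area_from k v"
    if "u \<in> paths 0 i" for u v i
  proof -
    have "area_from (Suc k) (u @ Down # v) = Suc k * i + area_from 0 u + area_from k v"
      using that assms area_from_append[of 0 u "Suc k" "Down # v"] by (simp add: paths_def)
    then show ?thesis by (simp only: power_add power_mult)
  qed
  then have "fps_nth (area_gf q (Suc k)) n = (\<Sum>i\<le>n. \<Sum>u\<in>paths 0 i. \<Sum>v\<in>paths k (n - i).
      (q ^ Suc k) ^ i * q ^ area_from 0 u * q ^ area_from k v)"
    by (simp add: area_gf_def sum_paths_Suc)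
  then show "fps_nth (area_gf q (Suc k)) n
      = fps_nth (scale (q ^ Suc k) (area_gf q 0) * area_gf q k) n"
    by (simp only: area_gf_def fps_mult_nth scale_nth atLeast0AtMost mult.assoc fps_nth_Abs_fps
        sum_product) (simp only: sum_distrib_left mult.assoc)
qed

lemma area_gf_equation:
  "area_gf q 0
    = 1 + fps_X * (scale (q ^ 2) (area_gf q 0) * (scale q (area_gf q 0) * area_gf q 0))"
proof -
  have gf_1: "area_gf q 1 = scale q (area_gf q 0) * area_gf q 0"
    using area_gf_Suc[of 0 q] area_from_shift_1[of 0] by simp
  have gf_2: "area_gf q 2 = scale (q ^ 2) (area_gf q 0) * area_gf q 1"
    using area_gf_Suc[of 1 q] area_from_shift_2[of 0] by (simp add: numeral_2_eq_2)
  show ?thesis by (subst area_gf_0) (simp only: gf_1 gf_2)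
qed

section \<open>Lattice paths and excess\<close>

lemma valid_iff:
  assumes "x \<le> 2 * y"
  shows "valid (2 * y - x) w \<longleftrightarrow>
    (case fold move w (x, y) of (a, b) \<Rightarrow> a = 2 * b) \<and>
    (\<forall>k \<le> length w. case fold move (take k w) (x, y) of (a, b) \<Rightarrow> a \<le> 2 * b)"
  using assms
proof (induction w arbitrary: x y)
  case Nil
  then show ?case by auto
next
  case (Cons d w)
  let ?P = "\<lambda>u. case fold move u (x, y) of (a, b) \<Rightarrow> a \<le> 2 * b"
  have prefixes: "(\<forall>k \<le> length (d # w). ?P (take k (d # w)))
      \<longleftrightarrow> ?P [] \<and> (\<forall>k \<le> length w. ?P (d # take k w))"
    using All_less_Suc2[of "Suc (length w)" "\<lambda>k. ?P (take k (d # w))"]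
    by (simp only: less_Suc_eq_le take_Suc_Cons take_0 list.size(4) add_0_right add_Suc_right)
  show ?case
  proof (cases d)
    case Up
    with Cons.IH[of x "y + 1"] Cons.prems show ?thesis
      unfolding prefixes by (simp add: Suc_diff_le)
  next
    case Down
    show ?thesis
    proof (cases "x = 2 * y")
      \<comment> \<open>A down step from the line x = 2y is refused by \<open>0 < e\<close> on one
        side and by the prefix of length one on the other; the witness 0 is the part of that prefix
        lying in \<open>w\<close>.\<close>
      case True
      with Down show ?thesis unfolding prefixes by (auto intro!: exI[of _ 0])
    next
      case False
      with Down Cons.IH[of "x + 1" y] Cons.prems show ?thesis
        unfolding prefixes by simp
    qed
  qed
qed

lemma fold_move_ups: "snd (fold move w p) = snd p + ups w"
proof (induction w arbitrary: p)
  case (Cons d w)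
  then show ?case by (cases d; cases p) simp_all
qed simp

lemma Dyck2_eq_paths: "Dyck2 n = paths 0 n"
proof (rule set_eqI)
  fix w
  show "w \<in> Dyck2 n \<longleftrightarrow> w \<in> paths 0 n"
    using valid_iff[of 0 0 w] fold_move_ups[of w "(0, 0)"]
    by (auto simp: Dyck2_def paths_def endpoint_def split: prod.splits)
qed

section \<open>Boxes and area\<close>

text \<open>The relation \<open>R\<close> covers boxes above and below a path at once; the free
  starting point \<open>p\<close> permits induction on the path.\<close>

definition boxes_from :: "(nat \<Rightarrow> nat \<Rightarrow> bool) \<Rightarrow> nat \<times> nat \<Rightarrow> step list \<Rightarrow> (nat \<times> nat) set"
  where "boxes_from R p w = {(i, j). \<exists>u v h. w = u @ Down # v \<and> fold move u p = (i, h) \<and> R h j}"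

lemma boxes_from_Nil: "boxes_from R p [] = {}"
  by (simp add: boxes_from_def)

lemma boxes_from_Cons:
  "(i, j) \<in> boxes_from R p (d # w)
    \<longleftrightarrow> d = Down \<and> fst p = i \<and> R (snd p) j \<or> (i, j) \<in> boxes_from R (move d p) w"
proof
  assume "(i, j) \<in> boxes_from R p (d # w)"
  then obtain u v h where u: "d # w = u @ Down # v" "fold move u p = (i, h)" "R h j"
    by (auto simp: boxes_from_def)
  then show "d = Down \<and> fst p = i \<and> R (snd p) j \<or> (i, j) \<in> boxes_from R (move d p) w"
    by (cases u) (auto simp: boxes_from_def)
next
  assume "d = Down \<and> fst p = i \<and> R (snd p) j \<or> (i, j) \<in> boxes_from R (move d p) w"
  then consider "d = Down" "fst p = i" "R (snd p) j"
    | u v h where "w = u @ Down # v" "fold move u (move d p) = (i, h)" "R h j"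
    by (auto simp: boxes_from_def)
  then show "(i, j) \<in> boxes_from R p (d # w)"
  proof cases
    case 1
    then show ?thesis by (cases p) (force simp: boxes_from_def)
  next
    case 2
    then have "d # w = (d # u) @ Down # v" "fold move (d # u) p = (i, h)" by simp_all
    with 2 show ?thesis unfolding boxes_from_def by blast
  qed
qed

lemma boxes_from_Up: "boxes_from R (x, y) (Up # w) = boxes_from R (x, y + 1) w"
  by (auto simp: boxes_from_Cons)

lemma boxes_from_Down:
  "boxes_from R (x, y) (Down # w) = {x} \<times> {j. R y j} \<union> boxes_from R (x + 1, y) w"
  by (auto simp: boxes_from_Cons)

lemmas boxes_from_simps = boxes_from_Nil boxes_from_Up boxes_from_Down

lemma boxes_above_lowest_path:
  "boxes_above (lowest_path n) = {(i, j). i < 2 * n \<and> i div 2 + 1 \<le> j}"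
proof -
  \<comment> \<open>Removing the first U D D moves the start by (2, 1), hence the general
    \<open>k\<close>. Columns \<open>2 * k\<close> and \<open>2 * k + 1\<close> are crossed at
    height \<open>k + 1 = i div 2 + 1\<close>.\<close>
  have "boxes_from (\<le>) (2 * k, k) (lowest_path n)
      = {(i, j). 2 * k \<le> i \<and> i < 2 * (k + n) \<and> i div 2 + 1 \<le> j}" for k
  proof (induction n arbitrary: k)
    case 0
    show ?case by (auto simp: lowest_path_def boxes_from_simps)
  next
    case (Suc n)
    have "lowest_path (Suc n) = Up # Down # Down # lowest_path n"
      by (simp add: lowest_path_def)
    with Suc[of "k + 1"] show ?case
      by (auto simp: boxes_from_simps)
  qed
  from this[of 0] show ?thesis
    by (simp add: boxes_above_def boxes_from_def endpoint_def)
qed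

lemma fst_fold_move: "fst p \<le> fst (fold move w p)"
proof (induction w arbitrary: p)
  case (Cons d w)
  from Cons[of "move d p"] show ?case by (cases d; cases p) simp_all
qed simp

text \<open>The lower bound separates the column of a down step from later columns; the upper bound
  supplies \<open>i < 2 * n\<close> for a complete path.\<close>

lemma boxes_from_columns:
  "boxes_from R (x, y) w \<subseteq> {x..<fst (fold move w (x, y))} \<times> UNIV"
proof (induction w arbitrary: x y)
  case (Cons d w)
  show ?case
  proof (cases d)
    case Up
    with Cons[of x "y + 1"] show ?thesis by (simp add: boxes_from_simps)
  next
    case Down
    have "x < fst (fold move w (x + 1, y))"
      using fst_fold_move[of "(x + 1, y)" w] by simp
    with Down Cons[of "x + 1" y] show ?thesis by (fastforce simp: boxes_from_simps)
  qed
qed (simp add: boxes_from_simps)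

text \<open>A down step from \<open>(x, y)\<close> contributes the boxes
  \<open>x div 2 + 1 \<le> j < y\<close> of column \<open>x\<close>. Their number is
  \<open>(2 * y - x - 1) div 2\<close>, the summand in \<open>area_from\<close>.\<close>

lemma card_boxes_from:
  assumes "x \<le> 2 * y" "valid (2 * y - x) w"
  defines "B \<equiv> {(i, j). i div 2 + 1 \<le> j} \<inter> boxes_from (\<lambda>h j. j + 1 \<le> h) (x, y) w"
  shows "finite B \<and> card B = area_from (2 * y - x) w"
  using assms(1,2) unfolding B_def
proof (induction w arbitrary: x y)
  case (Cons d w)
  show ?case
  proof (cases d)
    case Up
    with Cons.IH[of x "y + 1"] Cons.prems show ?thesis
      by (simp add: boxes_from_simps Suc_diff_le)
  next
    case Down
    let ?A = "{(i, j). i div 2 + 1 \<le> j}"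
    let ?B = "?A \<inter> boxes_from (\<lambda>h j. j + 1 \<le> h) (x + 1, y) w"
    from Down Cons.prems have xy: "x + 1 \<le> 2 * y" by auto
    with Down Cons.prems Cons.IH[of "x + 1" y]
    have B: "finite ?B" "card ?B = area_from (2 * y - x - 1) w" by simp_all
    have eq: "?A \<inter> boxes_from (\<lambda>h j. j + 1 \<le> h) (x, y) (d # w) = {x} \<times> {x div 2 + 1..<y} \<union> ?B"
      using Down by (auto simp: boxes_from_simps)
    have "{x} \<times> {x div 2 + 1..<y} \<inter> ?B = {}"
      using boxes_from_columns[of _ "x + 1" y w] by fastforce
    then have "card ({x} \<times> {x div 2 + 1..<y} \<union> ?B) = (y - (x div 2 + 1)) + card ?B"
      using B by (subst card_Un_disjoint) (auto simp: card_cartesian_product)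
    moreover have "y - (x div 2 + 1) = (2 * y - x - 1) div 2"
      using xy by linarith
    ultimately show ?thesis
      unfolding eq using B Down by simp
  qed
qed (simp add: boxes_from_simps)

lemma Area_eq_area_from:
  assumes "w \<in> Dyck2 n"
  shows "Area n w = area_from 0 w"
proof -
  let ?B = "boxes_from (\<lambda>h j. j + 1 \<le> h) (0, 0) w"
  \<comment> \<open>The path ends at abscissa \<open>2 * n\<close>, so the bound on \<open>i\<close>
    in \<open>boxes_above_lowest_path\<close> holds automatically.\<close>
  have "?B \<subseteq> {..<2 * n} \<times> UNIV"
    using assms boxes_from_columns[of "\<lambda>h j. j + 1 \<le> h" 0 0 w]
    by (auto simp: Dyck2_def endpoint_def)
  then have "boxes_above (lowest_path n) \<inter> boxes_below w = {(i, j). i div 2 + 1 \<le> j} \<inter> ?B"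
    unfolding boxes_above_lowest_path
    by (auto simp: boxes_below_def boxes_from_def endpoint_def)
  with assms card_boxes_from[of 0 0 w] show ?thesis
    by (simp add: Area_def Dyck2_eq_paths paths_def)
qed

section \<open>Specialisation of m and uniqueness at m = 1\<close>

lemma specialise_m_add: "specialise_m c (f + g) = specialise_m c f + specialise_m c g"
  by (simp add: specialise_m_def fps_eq_iff)

lemma specialise_m_mult: "specialise_m c (f * g) = specialise_m c f * specialise_m c g"
  by (simp add: specialise_m_def fps_eq_iff fps_mult_nth poly_sum)

lemma specialise_m_const: "specialise_m c (fps_const a) = fps_const (poly a c)"
  by (simp add: specialise_m_def fps_eq_iff)

lemma specialise_m_one: "specialise_m c 1 = 1"
  by (simp add: specialise_m_def fps_eq_iff)

lemma specialise_m_X: "specialise_m c fps_X = fps_X"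
  by (simp add: specialise_m_def fps_eq_iff)

lemma specialise_m_power: "specialise_m c (f ^ n) = specialise_m c f ^ n"
  by (induction n) (simp_all add: specialise_m_one specialise_m_mult)

text \<open>The powers of s introduced by the substitution are constant in m, so evaluation leaves
  them unchanged.\<close>

lemma specialise_m_shift_s: "specialise_m c (shift_s k f) = scale ([:0, 1:] ^ k) (specialise_m c f)"
  by (simp add: specialise_m_def fps_eq_iff shift_s_nth scale_nth)

lemma agree_scale: "agree n f g \<Longrightarrow> agree n (scale c f) (scale c g)"
  by (simp add: agree_def scale_nth)

definition zeta_equation_at_1 :: "'a::comm_ring_1 \<Rightarrow> 'a fps \<Rightarrow> bool"
  where "zeta_equation_at_1 q z \<longleftrightarrow>
    1 = (1 - fps_X * fps_const q) * z
      + fps_X * fps_const q * z * scale q z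
      + fps_X * fps_const q * z * scale q z * scale (q ^ 2) z
      + fps_X ^ 2 * fps_const q ^ 3 * z * scale q z * scale (q ^ 2) z * scale (q ^ 3) z"

lemma specialised_zeta_equation:
  assumes "zeta_equation \<zeta>"
  defines "Z \<equiv> specialise_m 1 \<zeta>" and "q \<equiv> [:0, 1:]"
  shows "zeta_equation_at_1 q Z"
proof -
  have s: "specialise_m 1 var_s = fps_const q"
    by (simp add: var_s_def specialise_m_const q_def)
  have m1: "specialise_m 1 (var_m - 1) = 0"
  proof -
    have "var_m - 1 = fps_const ([:0, 1:] - 1)"
      by (simp add: var_m_def flip: fps_const_1_eq_1)
    then show ?thesis by (simp only: specialise_m_const) simp
  qed
  have m2: "specialise_m 1 (var_m - 2) = - 1"
  proof -
    have "specialise_m 1 (var_m - 2) + 1 = specialise_m 1 (var_m - 2 + 1)"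
      by (simp only: specialise_m_add specialise_m_one)
    with m1 show ?thesis by (simp add: eq_neg_iff_add_eq_0)
  qed
  have "1 = specialise_m 1 1" by (simp add: specialise_m_one)
  also have "(1 :: int poly poly fps) = (1 + fps_X * var_s * (var_m - 2)) * \<zeta>
      + fps_X * var_s * \<zeta> * shift_s 1 \<zeta>
      + fps_X * var_s * (1 + fps_X * var_s ^ 2 * (var_m - 1)) * \<zeta> * shift_s 1 \<zeta> * shift_s 2 \<zeta>
      + fps_X ^ 2 * var_s ^ 3 * \<zeta> * shift_s 1 \<zeta> * shift_s 2 \<zeta> * shift_s 3 \<zeta>"
    using assms(1) unfolding zeta_equation_def .
  finally show ?thesis
    by (simp add: zeta_equation_at_1_def specialise_m_add specialise_m_mult specialise_m_one specialise_m_X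
        specialise_m_power specialise_m_shift_s s m1 m2 flip: Z_def q_def)
qed

text \<open>The equation reads z = 1 - r G(z), where G preserves agreement of coefficients below
  r^n. The factor r gains one coefficient, so \<open>contraction_unique_fixpoint\<close>
  applies.\<close>

lemma specialised_zeta_unique:
  fixes q :: "'a::comm_ring_1"
  assumes "zeta_equation_at_1 q y" "zeta_equation_at_1 q z"
  shows "y = z"
proof -
  define G where "G z = - fps_const q * z + fps_const q * z * scale q z
      + fps_const q * z * scale q z * scale (q ^ 2) z
      + fps_X * fps_const q ^ 3 * z * scale q z * scale (q ^ 2) z * scale (q ^ 3) z" for z
  have eq: "zeta_equation_at_1 q z \<longleftrightarrow> z = 1 - fps_X * G z" for z
  proof -
    have "zeta_equation_at_1 q z \<longleftrightarrow> 1 = z + fps_X * G z"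
      unfolding zeta_equation_at_1_def G_def
      by (simp del: fps_const_neg add: algebra_simps power2_eq_square)
    then show ?thesis by (auto simp: algebra_simps)
  qed
  have G: "agree n (G f) (G g)" if "agree n f g" for n f g
    unfolding G_def by (intro agree_add agree_mult agree_refl agree_scale that)
  have "agree (Suc n) (1 - fps_X * G f) (1 - fps_X * G g)" if "agree n f g" for n f g
    using G[OF that] by (auto simp: agree_def)
  then have "\<exists>!z. z = 1 - fps_X * G z"
    by (rule contraction_unique_fixpoint)
  with assms show ?thesis unfolding eq by auto
qed

section \<open>The path series solves the specialised equation\<close>

lemma area_gf_zeta_equation:
  "zeta_equation_at_1 q (scale (- q) (area_gf q 0))"
proof -
  define z where "z = scale (- q) (area_gf q 0)"
  have z: "z = 1 - fps_const q * fps_X * scale (q ^ 2) z * scale q z * z"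
    using arg_cong[OF area_gf_equation[of q], of "scale (- q)"] unfolding z_def
    by (simp add: scale_add scale_mult scale_one scale_scale scale_X mult_ac
        flip: fps_const_neg)
  \<comment> \<open>The substitution r := qr turns the prefactor qr into q^2 r and raises each
    scaling exponent by one.\<close>
  have z1: "scale q z
      = 1 - fps_const q ^ 2 * fps_X * scale (q ^ 3) z * scale (q ^ 2) z * scale q z"
    using arg_cong[OF z, of "scale q"]
    by (simp del: fps_const_mult fps_const_power
        add: scale_diff scale_mult scale_one scale_scale scale_const scale_X
          power2_eq_square power3_eq_cube mult_ac)
  let ?x = "fps_X * fps_const q"
  \<comment> \<open>The right-hand side of the equation is regrouped as the relation
    \<open>z\<close> plus \<open>?x * z\<close> times the defect in \<open>z1\<close>; the first
    equals 1 and the second vanishes.\<close>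
  have "(1 - ?x) * z + ?x * z * scale q z + ?x * z * scale q z * scale (q ^ 2) z
      + fps_X ^ 2 * fps_const q ^ 3 * z * scale q z * scale (q ^ 2) z * scale (q ^ 3) z
    = (z + fps_const q * fps_X * scale (q ^ 2) z * scale q z * z)
      + ?x * z * (scale q z
        - (1 - fps_const q ^ 2 * fps_X * scale (q ^ 3) z * scale (q ^ 2) z * scale q z))"
    by (simp del: fps_const_mult fps_const_power
        add: algebra_simps power2_eq_square power3_eq_cube)
  also have "\<dots> = 1" using z z1 by (simp add: algebra_simps)
  finally show ?thesis by (simp add: zeta_equation_at_1_def flip: z_def)
qed

theorem proposition4p14:
  fixes \<zeta> :: "int poly poly fps"
  assumes "zeta_equation \<zeta>"
  shows "(\<lambda>n. (- (fps_X * var_s')) ^ n * (\<Sum>\<mu>\<in>Dyck2 n. var_s' ^ Area n \<mu>))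
      sums specialise_m 1 \<zeta>"
proof -
  let ?q = "[:0, 1:] :: int poly"
  let ?z = "scale (- ?q) (area_gf ?q 0)"
  have eq: "specialise_m 1 \<zeta> = ?z"
    using specialised_zeta_equation[OF assms] area_gf_zeta_equation[of ?q]
    by (rule specialised_zeta_unique)
  \<comment> \<open>Each summand is a single monomial in r: the sign and the power of s are the
    factor \<open>(- ?q) ^ n\<close> that \<open>scale\<close> puts on the coefficient.\<close>
  have "(- (fps_X * var_s')) ^ n * (\<Sum>\<mu>\<in>Dyck2 n. var_s' ^ Area n \<mu>)
      = fps_const (fps_nth ?z n) * fps_X ^ n" for n
  proof -
    have "- (fps_X * var_s') = fps_const (- ?q) * fps_X"
      by (simp add: var_s'_def mult.commute flip: fps_const_neg)
    then have "(- (fps_X * var_s')) ^ n = fps_const ((- ?q) ^ n) * fps_X ^ n"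
      by (simp only: power_mult_distrib fps_const_power)
    moreover have "(\<Sum>\<mu>\<in>Dyck2 n. var_s' ^ Area n \<mu>) = fps_const (fps_nth (area_gf ?q 0) n)"
      by (simp add: var_s'_def Area_eq_area_from area_gf_def Dyck2_eq_paths[symmetric]
          fps_const_power fps_eq_iff fps_sum_nth)
    ultimately show ?thesis
      by (simp add: scale_nth mult_ac flip: fps_const_mult)
  qed
  \<comment> \<open>The partial sums are thus the truncations of \<open>?z\<close>, which converge
    to it in the topology of formal power series.\<close>
  then show ?thesis
    unfolding eq sums_def' using fps_notation[of ?z] by simp
qed

end
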